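(* Let $\mathsf{V}=(\mathsf{V},\otimes,k)$ be a commutative quantale, let $A$ be a $\mathsf{V}$-category and let $X$ be a complete $\mathsf{V}$-category. For $a\in A$, $x\in X$ define $$\iota(a,x)\colon A^{\mathrm{op}}\to X,\ \iota(a,x)b=A(b,a)\star x,\qquad \iota^{\dagger}(a,x)\colon A\to X,\ \iota^{\dagger}(a,x)b=A(a,b)\star x,$$ where $\star$ denotes tensors in $X$. Then $\iota\colon A\otimes X\to X^{A^{\mathrm{op}}}$ is a dense $\mathsf{V}$-bifunctor, and $\iota^{\dagger}\colon A\otimes X^{\mathrm{op}}\to(X^A)^{\mathrm{op}}$ is a codense $\mathsf{V}$-bifunctor.
   Context: A commutative quantale is a commutative monoid $(\mathsf{V},\otimes,k)$ whose underlying set is a complete lattice with $x\otimes\bigvee_i y_i=\bigvee_i x\otimes y_i$; the implication $\to$ is defined by $x\otimes y\leq z\iff x\leq y\to z$. A $\mathsf{V}$-category is a set $X$ with a map $X(-,-)\colon X\times X\to\mathsf{V}$ such that $k\leq X(x,x)$ and $X(x,y)\otimes X(y,z)\leq X(x,z)$. Its underlying preorder is $x\leq y\iff k\leq X(x,y)$; $x\cong y$ means $x\leq y$ and $y\leq x$. A $\mathsf{V}$-functor $f\colon X\to Y$ is a map with $X(x,y)\leq Y(fx,fy)$. $\mathsf{V}$ is a $\mathsf{V}$-category via $\mathsf{V}(x,y)=x\to y$. $X^{\mathrm{op}}$ has the same objects with $X^{\mathrm{op}}(x,y)=X(y,x)$. $X\otimes Y$ has object set $X\times Y$ and $(X\otimes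 Y)((x,y),(x',y'))=X(x,x')\otimes Y(y,y')$. $Y^X$ is the $\mathsf{V}$-category of $\mathsf{V}$-functors $X\to Y$ with $Y^X(f,g)=\bigwedge_{x\in X}Y(fx,gx)$. A $\mathsf{V}$-bifunctor is a $\mathsf{V}$-functor $X\otimes Y\to Z$. A supremum of $\mu\in\mathsf{V}^{X^{\mathrm{op}}}$ is an object $\sup\mu\in X$ with $X(\sup\mu,x)=\bigwedge_{y\in X}\mu y\to X(y,x)$ for all $x\in X$; an infimum of $\lambda\in\mathsf{V}^X$ is an object $\inf\lambda\in X$ with $X(x,\inf\lambda)=\bigwedge_{y\in X}\lambda y\to X(x,y)$ for all $x\in X$. $X$ is complete if every $\lambda\in\mathsf{V}^X$ has an infimum; equivalently every $\mu\in\mathsf{V}^{X^{\mathrm{op}}}$ has a supremum. The tensor of $v\in\mathsf{V}$ and $x\in X$ is an object $v\star x\in X$ (determined up to $\cong$; a choice is fixed) with $X(v\star x,y)=v\to X(x,y)$ for all $y\in X$; all tensors exist in a complete $\mathsf{V}$-category. A $\mathsf{V}$-functor $f\colon X\to Y$ is dense if for every $y\in Y$ there is $\mu\in\mathsf{V}^{X^{\mathrm{op}}}$ such that $y$ is a supremum of the presheaf $y'\mapsto\bigvee_{x\in X}Y(y',fx)\otimes\mu x$ on $Y$; it is codense if for every $y\in Y$ there is $\lambda\in\mathsf{V}^X$ such that $y$ is an infimum of the copresheaf $y'\mapsto\bigvee_{x\in X}Y(fx,y')\otimes\lambda x$ on $Y$. *)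

theory Defs
  imports Main "HOL-Library.FuncSet"
begin

section \<open>Commutative quantales\<close>

text \<open>The monoidal unit \<open>k\<close> is \<open>1\<close> and the tensor of the quantale is \<open>*\<close>.\<close>

class comm_quantale = complete_lattice + comm_monoid_mult +
  assumes mult_Sup: "x * Sup Y = (SUP y\<in>Y. x * y)"

definition qimp :: "'v::comm_quantale \<Rightarrow> 'v \<Rightarrow> 'v"  (infixr "\<rightarrow>\<^sub>q" 60)
  where "y \<rightarrow>\<^sub>q z = Sup {x. x * y \<le> z}"

lemma mult_mono_quantale:
  fixes x y z :: "'v::comm_quantale"
  assumes "y \<le> z"
  shows "x * y \<le> x * z"
proof -
  have "x * z = x * Sup {y, z}"
    using assms by (simp add: sup_absorb2)
  also have "\<dots> = (SUP w\<in>{y, z}. x * w)"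
    by (rule mult_Sup)
  finally show ?thesis
    by (simp add: le_iff_sup)
qed

lemma qimp_adjoint: "x * y \<le> z \<longleftrightarrow> x \<le> y \<rightarrow>\<^sub>q z"
  for x y z :: "'v::comm_quantale"
proof
  assume "x * y \<le> z"
  then show "x \<le> y \<rightarrow>\<^sub>q z"
    unfolding qimp_def by (intro Sup_upper) simp
next
  assume "x \<le> y \<rightarrow>\<^sub>q z"
  then have "y * x \<le> y * (y \<rightarrow>\<^sub>q z)"
    by (rule mult_mono_quantale)
  also have "\<dots> = (SUP w\<in>{w. w * y \<le> z}. y * w)"
    unfolding qimp_def by (rule mult_Sup)
  also have "\<dots> \<le> z"
    by (auto intro!: SUP_least simp: mult.commute)
  finally show "x * y \<le> z"
    by (simp add: mult.commute)
qed


section \<open>Categories enriched in a quantale\<close>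

record ('a, 'v) vcat =
  Obj :: "'a set"
  Hom :: "'a \<Rightarrow> 'a \<Rightarrow> 'v"

definition vcategory :: "('a, 'v::comm_quantale) vcat \<Rightarrow> bool"
  where "vcategory X \<longleftrightarrow>
    (\<forall>x\<in>Obj X. 1 \<le> Hom X x x) \<and>
    (\<forall>x\<in>Obj X. \<forall>y\<in>Obj X. \<forall>z\<in>Obj X. Hom X x y * Hom X y z \<le> Hom X x z)"

definition vfunctor ::
    "('a, 'v::comm_quantale) vcat \<Rightarrow> ('b, 'v) vcat \<Rightarrow> ('a \<Rightarrow> 'b) \<Rightarrow> bool"
  where "vfunctor X Y f \<longleftrightarrow>
    f \<in> Obj X \<rightarrow> Obj Y \<and>
    (\<forall>x\<in>Obj X. \<forall>y\<in>Obj X. Hom X x y \<le> Hom Y (f x) (f y))"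

definition Vcat :: "('v::comm_quantale, 'v) vcat"
  where "Vcat = \<lparr>Obj = UNIV, Hom = (\<lambda>x y. x \<rightarrow>\<^sub>q y)\<rparr>"

definition vop :: "('a, 'v::comm_quantale) vcat \<Rightarrow> ('a, 'v) vcat"
  where "vop X = \<lparr>Obj = Obj X, Hom = (\<lambda>x y. Hom X y x)\<rparr>"

definition vtimes ::
    "('a, 'v::comm_quantale) vcat \<Rightarrow> ('b, 'v) vcat \<Rightarrow> ('a \<times> 'b, 'v) vcat"  (infixr "\<otimes>\<^sub>v" 70)
  where "X \<otimes>\<^sub>v Y = \<lparr>Obj = Obj X \<times> Obj Y,
                    Hom = (\<lambda>(x, y) (x', y'). Hom X x x' * Hom Y y y')\<rparr>"

text \<open>The functor category written \<open>Y\<close> to the power \<open>X\<close>. Its objects are extensional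
  functions, so that each map on the carrier of \<open>X\<close> is represented exactly once.\<close>

definition vfun ::
    "('a, 'v::comm_quantale) vcat \<Rightarrow> ('b, 'v) vcat \<Rightarrow> ('a \<Rightarrow> 'b, 'v) vcat"
  where "vfun X Y = \<lparr>Obj = {f \<in> extensional (Obj X). vfunctor X Y f},
                     Hom = (\<lambda>f g. INF x\<in>Obj X. Hom Y (f x) (g x))\<rparr>"

abbreviation vbifunctor ::
    "('a, 'v::comm_quantale) vcat \<Rightarrow> ('b, 'v) vcat \<Rightarrow> ('c, 'v) vcat \<Rightarrow> ('a \<times> 'b \<Rightarrow> 'c) \<Rightarrow> bool"
  where "vbifunctor X Y Z f \<equiv> vfunctor (X \<otimes>\<^sub>v Y) Z f"

abbreviation presheaves :: "('a, 'v::comm_quantale) vcat \<Rightarrow> ('a \<Rightarrow> 'v) set"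
  where "presheaves X \<equiv> Obj (vfun (vop X) Vcat)"

abbreviation copresheaves :: "('a, 'v::comm_quantale) vcat \<Rightarrow> ('a \<Rightarrow> 'v) set"
  where "copresheaves X \<equiv> Obj (vfun X Vcat)"

lemma vcategory_Vcat: "vcategory (Vcat :: ('v::comm_quantale, 'v) vcat)"
proof -
  have "(x \<rightarrow>\<^sub>q y) * (y \<rightarrow>\<^sub>q z) \<le> x \<rightarrow>\<^sub>q z" for x y z :: 'v
  proof -
    have "(y \<rightarrow>\<^sub>q z) * ((x \<rightarrow>\<^sub>q y) * x) \<le> (y \<rightarrow>\<^sub>q z) * y"
      by (rule mult_mono_quantale) (simp add: qimp_adjoint)
    also have "\<dots> \<le> z"
      by (simp add: qimp_adjoint)
    finally have "((x \<rightarrow>\<^sub>q y) * (y \<rightarrow>\<^sub>q z)) * x \<le> z"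
      by (simp add: mult_ac)
    then show ?thesis
      by (simp only: qimp_adjoint)
  qed
  moreover have "1 \<le> x \<rightarrow>\<^sub>q x" for x :: 'v
    by (simp flip: qimp_adjoint)
  ultimately show ?thesis
    by (simp add: vcategory_def Vcat_def)
qed

lemma vcategory_vop: "vcategory X \<Longrightarrow> vcategory (vop X)"
  by (simp add: vcategory_def vop_def) (metis mult.commute)

lemma mult_mono2_quantale:
  fixes a b c d :: "'v::comm_quantale"
  assumes "a \<le> b" and "c \<le> d"
  shows "a * c \<le> b * d"
  using mult_mono_quantale[OF assms(1), of c] mult_mono_quantale[OF assms(2), of b]
  by (metis mult.commute order_trans)

lemma vcategory_vtimes:
  assumes "vcategory X" and "vcategory Y"
  shows "vcategory (X \<otimes>\<^sub>v Y)"
proof -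
  have "1 \<le> Hom X x x * Hom Y y y" if "x \<in> Obj X" "y \<in> Obj Y" for x y
    using mult_mono2_quantale[of 1 "Hom X x x" 1 "Hom Y y y"] assms that
    by (simp add: vcategory_def)
  moreover have "(Hom X x x' * Hom Y y y') * (Hom X x' x'' * Hom Y y' y'')
      \<le> Hom X x x'' * Hom Y y y''"
    if "x \<in> Obj X" "x' \<in> Obj X" "x'' \<in> Obj X" "y \<in> Obj Y" "y' \<in> Obj Y" "y'' \<in> Obj Y"
    for x x' x'' y y' y''
  proof -
    have "(Hom X x x' * Hom X x' x'') * (Hom Y y y' * Hom Y y' y'')
        \<le> Hom X x x'' * Hom Y y y''"
      using assms that by (intro mult_mono2_quantale) (auto simp: vcategory_def)
    then show ?thesis
      by (simp add: mult_ac)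
  qed
  ultimately show ?thesis
    by (auto simp: vcategory_def vtimes_def)
qed

lemma vcategory_vfun:
  assumes "vcategory Y"
  shows "vcategory (vfun X Y)"
proof -
  have "1 \<le> (INF x\<in>Obj X. Hom Y (f x) (f x))" if "f \<in> Obj X \<rightarrow> Obj Y" for f
    using assms that by (auto simp: vcategory_def intro!: INF_greatest)
  moreover have "(INF x\<in>Obj X. Hom Y (f x) (g x)) * (INF x\<in>Obj X. Hom Y (g x) (h x))
      \<le> (INF x\<in>Obj X. Hom Y (f x) (h x))"
    if "f \<in> Obj X \<rightarrow> Obj Y" "g \<in> Obj X \<rightarrow> Obj Y" "h \<in> Obj X \<rightarrow> Obj Y" for f g h
  proof (rule INF_greatest)
    fix x assume x: "x \<in> Obj X"
    have "(INF x\<in>Obj X. Hom Y (f x) (g x)) * (INF x\<in>Obj X. Hom Y (g x) (h x))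
        \<le> Hom Y (f x) (g x) * Hom Y (g x) (h x)"
      using x by (intro mult_mono2_quantale INF_lower)
    also have "\<dots> \<le> Hom Y (f x) (h x)"
      using assms that x by (auto simp: vcategory_def Pi_iff)
    finally show "(INF x\<in>Obj X. Hom Y (f x) (g x)) * (INF x\<in>Obj X. Hom Y (g x) (h x))
        \<le> Hom Y (f x) (h x)" .
  qed
  ultimately show ?thesis
    by (auto simp: vcategory_def vfun_def vfunctor_def)
qed


section \<open>Suprema, infima, completeness and tensors\<close>

definition is_supremum :: "('a, 'v::comm_quantale) vcat \<Rightarrow> ('a \<Rightarrow> 'v) \<Rightarrow> 'a \<Rightarrow> bool"
  where "is_supremum X \<mu> s \<longleftrightarrow>
    s \<in> Obj X \<and> (\<forall>x\<in>Obj X. Hom X s x = (INF y\<in>Obj X. \<mu> y \<rightarrow>\<^sub>q Hom X y x))"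

definition is_infimum :: "('a, 'v::comm_quantale) vcat \<Rightarrow> ('a \<Rightarrow> 'v) \<Rightarrow> 'a \<Rightarrow> bool"
  where "is_infimum X \<phi> s \<longleftrightarrow>
    s \<in> Obj X \<and> (\<forall>x\<in>Obj X. Hom X x s = (INF y\<in>Obj X. \<phi> y \<rightarrow>\<^sub>q Hom X x y))"

definition vcomplete :: "('a, 'v::comm_quantale) vcat \<Rightarrow> bool"
  where "vcomplete X \<longleftrightarrow> (\<forall>\<phi>\<in>copresheaves X. \<exists>s. is_infimum X \<phi> s)"

definition is_tensor :: "('a, 'v::comm_quantale) vcat \<Rightarrow> 'v \<Rightarrow> 'a \<Rightarrow> 'a \<Rightarrow> bool"
  where "is_tensor X v x t \<longleftrightarrow>
    t \<in> Obj X \<and> (\<forall>y\<in>Obj X. Hom X t y = v \<rightarrow>\<^sub>q Hom X x y)"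

text \<open>A choice of tensors: tensors are determined only up to isomorphism, and
  \<open>star v x\<close> is the chosen one.\<close>

definition tensor_choice :: "('a, 'v::comm_quantale) vcat \<Rightarrow> ('v \<Rightarrow> 'a \<Rightarrow> 'a) \<Rightarrow> bool"
  where "tensor_choice X star \<longleftrightarrow> (\<forall>v. \<forall>x\<in>Obj X. is_tensor X v x (star v x))"

lemma vcomplete_ex_tensor_choice:
  fixes X :: "('a, 'v::comm_quantale) vcat"
  assumes X: "vcategory X" and c: "vcomplete X"
  shows "\<exists>star. tensor_choice X star"
proof -
  have "\<exists>t. is_tensor X v x t" if x: "x \<in> Obj X" for v x
  proof -
    define l where "l = (\<lambda>y\<in>Obj X. v \<rightarrow>\<^sub>q Hom X x y)"
    have "Hom X y z \<le> l y \<rightarrow>\<^sub>q l z" if "y \<in> Obj X" "z \<in> Obj X" for y z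
    proof -
      have "Hom X y z * ((v \<rightarrow>\<^sub>q Hom X x y) * v) \<le> Hom X y z * Hom X x y"
        by (rule mult_mono_quantale) (simp add: qimp_adjoint)
      also have "\<dots> \<le> Hom X x z"
        using X x that by (auto simp: vcategory_def mult.commute)
      finally have "Hom X y z * (v \<rightarrow>\<^sub>q Hom X x y) * v \<le> Hom X x z"
        by (simp add: mult_ac)
      then show ?thesis
        using that by (simp only: qimp_adjoint l_def restrict_apply if_True)
    qed
    then have "l \<in> copresheaves X"
      by (simp add: vfun_def vfunctor_def Vcat_def l_def)
    then obtain s where s: "s \<in> Obj X"
      and inf: "\<And>z. z \<in> Obj X \<Longrightarrow> Hom X z s = (INF y\<in>Obj X. l y \<rightarrow>\<^sub>q Hom X z y)"
      using c by (auto simp: vcomplete_def is_infimum_def)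
    have v: "v \<le> Hom X x s"
      unfolding inf[OF x]
    proof (rule INF_greatest)
      fix y assume y: "y \<in> Obj X"
      have "(v \<rightarrow>\<^sub>q Hom X x y) * v \<le> Hom X x y"
        by (simp only: qimp_adjoint order.refl)
      then have "v * l y \<le> Hom X x y"
        using y by (simp add: l_def mult.commute)
      then show "v \<le> l y \<rightarrow>\<^sub>q Hom X x y"
        by (simp only: qimp_adjoint)
    qed
    have "Hom X s y = v \<rightarrow>\<^sub>q Hom X x y" if y: "y \<in> Obj X" for y
    proof (rule order.antisym)
      have "Hom X s y * v \<le> Hom X s y * Hom X x s"
        by (rule mult_mono_quantale) (rule v)
      also have "\<dots> \<le> Hom X x y"
        using X x s y by (auto simp: vcategory_def mult.commute)
      finally show "Hom X s y \<le> v \<rightarrow>\<^sub>q Hom X x y"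
        by (simp only: qimp_adjoint)
    next
      have "1 \<le> Hom X s s"
        using X s by (simp add: vcategory_def)
      also have "\<dots> \<le> l y \<rightarrow>\<^sub>q Hom X s y"
        unfolding inf[OF s] using y by (rule INF_lower)
      finally have "1 * l y \<le> Hom X s y"
        by (simp only: qimp_adjoint)
      then show "v \<rightarrow>\<^sub>q Hom X x y \<le> Hom X s y"
        using y by (simp add: l_def)
    qed
    then show ?thesis
      using s by (auto simp: is_tensor_def)
  qed
  then have "tensor_choice X (\<lambda>v x. SOME t. is_tensor X v x t)"
    unfolding tensor_choice_def by (blast intro: someI_ex)
  then show ?thesis
    by (rule exI[where P = "tensor_choice X"])
qed


section \<open>Density and the maps in question\<close>

definition vdense ::
    "('a, 'v::comm_quantale) vcat \<Rightarrow> ('b, 'v) vcat \<Rightarrow> ('a \<Rightarrow> 'b) \<Rightarrow> bool"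
  where "vdense X Y f \<longleftrightarrow> (\<forall>y\<in>Obj Y. \<exists>\<mu>\<in>presheaves X.
    is_supremum Y (\<lambda>y'\<in>Obj Y. SUP x\<in>Obj X. Hom Y y' (f x) * \<mu> x) y)"

definition vcodense ::
    "('a, 'v::comm_quantale) vcat \<Rightarrow> ('b, 'v) vcat \<Rightarrow> ('a \<Rightarrow> 'b) \<Rightarrow> bool"
  where "vcodense X Y f \<longleftrightarrow> (\<forall>y\<in>Obj Y. \<exists>\<phi>\<in>copresheaves X.
    is_infimum Y (\<lambda>y'\<in>Obj Y. SUP x\<in>Obj X. Hom Y (f x) y' * \<phi> x) y)"

definition iota ::
    "('a, 'v::comm_quantale) vcat \<Rightarrow> ('v \<Rightarrow> 'x \<Rightarrow> 'x) \<Rightarrow> 'a \<times> 'x \<Rightarrow> 'a \<Rightarrow> 'x"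
  where "iota A star = (\<lambda>(a, x). \<lambda>b\<in>Obj A. star (Hom A b a) x)"

definition iota_dagger ::
    "('a, 'v::comm_quantale) vcat \<Rightarrow> ('v \<Rightarrow> 'x \<Rightarrow> 'x) \<Rightarrow> 'a \<times> 'x \<Rightarrow> 'a \<Rightarrow> 'x"
  where "iota_dagger A star = (\<lambda>(a, x). \<lambda>b\<in>Obj A. star (Hom A a b) x)"

end

theory Submission
  imports Defs
begin

text \<open>The Yoneda lemma carries the proof. Since
  \<open>\<iota> (a, x)\<close> is the representable of \<open>a\<close> tensored with \<open>x\<close>, maps
  out of it are computed by evaluation: for a functor \<open>g\<close> on the opposite of \<open>A\<close>,
  the hom from \<open>\<iota> (a, x)\<close> to \<open>g\<close> is \<open>X(x, g a)\<close>
  (\<open>Hom_iota\<close>). Functoriality of \<open>\<iota>\<close> then becomes a statement about homs of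
  the form \<open>X(x, A(a, a') \<star> x')\<close>.

  For density, every \<open>g\<close> is weighted by its own nerve, the presheaf
  \<open>(a, x) \<mapsto> X(x, g a)\<close>. The extension of the nerve along \<open>\<iota>\<close> has \<open>g\<close> as a
  supremum as soon as the nerve construction is fully faithful
  (\<open>dense_if_nerve_fully_faithful\<close>), that is, as soon as the hom from \<open>g\<close> to \<open>h\<close> is
  the meet of \<open>X(x, g a) \<rightarrow> X(x, h a)\<close> over all \<open>a\<close> and \<open>x\<close>. By the
  Yoneda lemma in \<open>X\<close> the meet over \<open>x\<close> is \<open>X(g a, h a)\<close>, and the meet of these over
  \<open>a\<close> is the hom of the functor category.

  The claim about \<open>\<iota>\<^sup>\<dagger>\<close> is the first one for the opposite of \<open>A\<close>, read in
  opposite categories: \<open>\<iota>\<^sup>\<dagger>\<close> for \<open>A\<close> is \<open>\<iota>\<close> for the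
  opposite of \<open>A\<close>, and a functor is codense when its opposite is dense.\<close>

lemma qimp_mult: "(x * y) \<rightarrow>\<^sub>q z = x \<rightarrow>\<^sub>q (y \<rightarrow>\<^sub>q z)"
  for x y z :: "'v::comm_quantale"
proof (rule order.antisym)
  have "((x * y) \<rightarrow>\<^sub>q z) * x * y \<le> z"
    by (simp add: qimp_adjoint mult.assoc)
  then show "(x * y) \<rightarrow>\<^sub>q z \<le> x \<rightarrow>\<^sub>q (y \<rightarrow>\<^sub>q z)"
    by (simp only: qimp_adjoint)
next
  have "(x \<rightarrow>\<^sub>q (y \<rightarrow>\<^sub>q z)) * x * y \<le> z"
    by (simp add: qimp_adjoint)
  then show "x \<rightarrow>\<^sub>q (y \<rightarrow>\<^sub>q z) \<le> (x * y) \<rightarrow>\<^sub>q z"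
    by (simp add: mult.assoc flip: qimp_adjoint)
qed

lemma le_qimp_commute: "x \<le> y \<rightarrow>\<^sub>q z \<longleftrightarrow> y \<le> x \<rightarrow>\<^sub>q z"
  for x y z :: "'v::comm_quantale"
  by (simp add: mult.commute flip: qimp_adjoint)

lemma SUP_qimp: "(SUP i\<in>I. f i) \<rightarrow>\<^sub>q z = (INF i\<in>I. f i \<rightarrow>\<^sub>q z)"
  for z :: "'v::comm_quantale"
proof -
  have "x \<le> (SUP i\<in>I. f i) \<rightarrow>\<^sub>q z \<longleftrightarrow> x \<le> (INF i\<in>I. f i \<rightarrow>\<^sub>q z)" for x
    by (simp add: le_qimp_commute[of x] SUP_le_iff le_INF_iff)
  then show ?thesis
    by (meson order.antisym order.refl)
qed

lemma qimp_INF: "v \<rightarrow>\<^sub>q (INF i\<in>I. f i) = (INF i\<in>I. v \<rightarrow>\<^sub>q f i)"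
  for v :: "'v::comm_quantale"
proof -
  have "x \<le> v \<rightarrow>\<^sub>q (INF i\<in>I. f i) \<longleftrightarrow> x \<le> (INF i\<in>I. v \<rightarrow>\<^sub>q f i)" for x
    by (simp add: le_INF_iff flip: qimp_adjoint)
  then show ?thesis
    by (meson order.antisym order.refl)
qed

lemma Hom_refl: "vcategory X \<Longrightarrow> x \<in> Obj X \<Longrightarrow> 1 \<le> Hom X x x"
  by (simp add: vcategory_def)

lemma Hom_comp:
  "vcategory X \<Longrightarrow> x \<in> Obj X \<Longrightarrow> y \<in> Obj X \<Longrightarrow> z \<in> Obj X \<Longrightarrow>
    Hom X x y * Hom X y z \<le> Hom X x z"
  by (simp add: vcategory_def)

lemma vop_simps [simp]: "Obj (vop X) = Obj X" "Hom (vop X) x y = Hom X y x"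
  by (simp_all add: vop_def)

lemma vtimes_simps [simp]:
  "Obj (X \<otimes>\<^sub>v Y) = Obj X \<times> Obj Y"
  "Hom (X \<otimes>\<^sub>v Y) (x, y) (x', y') = Hom X x x' * Hom Y y y'"
  by (simp_all add: vtimes_def)

lemma Obj_vfun_iff: "f \<in> Obj (vfun X Y) \<longleftrightarrow> f \<in> extensional (Obj X) \<and> vfunctor X Y f"
  by (simp add: vfun_def)

lemma Hom_vfun [simp]: "Hom (vfun X Y) f g = (INF x\<in>Obj X. Hom Y (f x) (g x))"
  by (simp add: vfun_def)

lemma vfunctor_Obj: "vfunctor X Y f \<Longrightarrow> x \<in> Obj X \<Longrightarrow> f x \<in> Obj Y"
  by (auto simp: vfunctor_def)

lemma vfunctor_Hom:
  "vfunctor X Y f \<Longrightarrow> x \<in> Obj X \<Longrightarrow> y \<in> Obj X \<Longrightarrow> Hom X x y \<le> Hom Y (f x) (f y)"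
  by (simp add: vfunctor_def)

text \<open>The Yoneda lemma, with the presheaf given only through its action on \<open>Obj X\<close>:
  the action bounds the meet from below, and the identity at \<open>a\<close> from above.\<close>

lemma yoneda:
  assumes X: "vcategory X" and a: "a \<in> Obj X"
    and act: "\<And>b. b \<in> Obj X \<Longrightarrow> Hom X b a * P a \<le> P b"
  shows "(INF b\<in>Obj X. Hom X b a \<rightarrow>\<^sub>q P b) = P a"
proof (rule order.antisym)
  have "(INF b\<in>Obj X. Hom X b a \<rightarrow>\<^sub>q P b) \<le> Hom X a a \<rightarrow>\<^sub>q P a"
    using a by (rule INF_lower)
  then have "Hom X a a \<le> (INF b\<in>Obj X. Hom X b a \<rightarrow>\<^sub>q P b) \<rightarrow>\<^sub>q P a"
    by (simp only: le_qimp_commute)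
  then have "1 \<le> (INF b\<in>Obj X. Hom X b a \<rightarrow>\<^sub>q P b) \<rightarrow>\<^sub>q P a"
    using Hom_refl[OF X a] by (rule order.trans[rotated])
  then show "(INF b\<in>Obj X. Hom X b a \<rightarrow>\<^sub>q P b) \<le> P a"
    by (simp flip: qimp_adjoint)
next
  show "P a \<le> (INF b\<in>Obj X. Hom X b a \<rightarrow>\<^sub>q P b)"
    using act by (intro INF_greatest) (simp add: mult.commute flip: qimp_adjoint)
qed

lemma yoneda_Hom:
  assumes X: "vcategory X" and "y \<in> Obj X" "z \<in> Obj X"
  shows "(INF x\<in>Obj X. Hom X x y \<rightarrow>\<^sub>q Hom X x z) = Hom X y z"
  using assms by (intro yoneda[where P = "\<lambda>x. Hom X x z"]) (auto intro: Hom_comp)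

text \<open>Extending a weight along \<open>f\<close> does not change its cocones: the meet over the
  objects \<open>y'\<close> of \<open>Y\<close> is absorbed by the Yoneda lemma in \<open>Y\<close>. The suprema
  appearing in density are therefore colimits of \<open>f\<close> weighted by \<open>\<mu>\<close>.\<close>

lemma cocones_extended_weight:
  assumes Y: "vcategory Y" and f: "f \<in> Obj X \<rightarrow> Obj Y" and z: "z \<in> Obj Y"
  shows "(INF y'\<in>Obj Y. (SUP x\<in>Obj X. Hom Y y' (f x) * \<mu> x) \<rightarrow>\<^sub>q Hom Y y' z)
    = (INF x\<in>Obj X. \<mu> x \<rightarrow>\<^sub>q Hom Y (f x) z)"
proof -
  have "(INF y'\<in>Obj Y. (SUP x\<in>Obj X. Hom Y y' (f x) * \<mu> x) \<rightarrow>\<^sub>q Hom Y y' z)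
      = (INF y'\<in>Obj Y. INF x\<in>Obj X. \<mu> x \<rightarrow>\<^sub>q (Hom Y y' (f x) \<rightarrow>\<^sub>q Hom Y y' z))"
    by (simp add: SUP_qimp mult.commute[of _ "\<mu> _"] qimp_mult)
  also have "\<dots> = (INF x\<in>Obj X. INF y'\<in>Obj Y. \<mu> x \<rightarrow>\<^sub>q (Hom Y y' (f x) \<rightarrow>\<^sub>q Hom Y y' z))"
    by (rule INF_commute)
  also have "\<dots> = (INF x\<in>Obj X. \<mu> x \<rightarrow>\<^sub>q Hom Y (f x) z)"
    using f by (intro INF_cong refl) (simp add: yoneda_Hom[OF Y _ z] Pi_iff flip: qimp_INF)
  finally show ?thesis .
qed

lemma nerve_in_presheaves:
  assumes Y: "vcategory Y" and f: "vfunctor X Y f" and y: "y \<in> Obj Y"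
  shows "(\<lambda>x\<in>Obj X. Hom Y (f x) y) \<in> presheaves X"
proof -
  have "Hom X x' x \<le> Hom Y (f x) y \<rightarrow>\<^sub>q Hom Y (f x') y"
    if x: "x \<in> Obj X" and x': "x' \<in> Obj X" for x x'
  proof -
    have "Hom X x' x \<le> Hom Y (f x') (f x)"
      using f x' x by (rule vfunctor_Hom)
    also have "\<dots> \<le> Hom Y (f x) y \<rightarrow>\<^sub>q Hom Y (f x') y"
      using Hom_comp[OF Y vfunctor_Obj[OF f x'] vfunctor_Obj[OF f x] y]
      by (simp only: qimp_adjoint)
    finally show ?thesis .
  qed
  then show ?thesis
    by (simp add: Obj_vfun_iff vfunctor_def Vcat_def)
qed

text \<open>The hypothesis says that the nerve, which sends \<open>y\<close> to the presheaf
  \<open>Y(f -, y)\<close>, is fully faithful. It makes every \<open>y\<close> the colimit of \<open>f\<close>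
  weighted by the nerve of \<open>y\<close>.\<close>

lemma dense_if_nerve_fully_faithful:
  assumes Y: "vcategory Y" and f: "vfunctor X Y f"
    and ff: "\<And>y z. y \<in> Obj Y \<Longrightarrow> z \<in> Obj Y \<Longrightarrow>
      Hom Y y z = (INF x\<in>Obj X. Hom Y (f x) y \<rightarrow>\<^sub>q Hom Y (f x) z)"
  shows "vdense X Y f"
  unfolding vdense_def
proof
  fix y assume y: "y \<in> Obj Y"
  let ?\<mu> = "\<lambda>x\<in>Obj X. Hom Y (f x) y"
  have f': "f \<in> Obj X \<rightarrow> Obj Y"
    using f by (simp add: vfunctor_def)
  have "is_supremum Y (\<lambda>y'\<in>Obj Y. SUP x\<in>Obj X. Hom Y y' (f x) * ?\<mu> x) y"
    unfolding is_supremum_def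
  proof (intro conjI ballI y)
    fix z assume z: "z \<in> Obj Y"
    have "Hom Y y z = (INF x\<in>Obj X. ?\<mu> x \<rightarrow>\<^sub>q Hom Y (f x) z)"
      using ff[OF y z] by simp
    also have "\<dots> = (INF y'\<in>Obj Y. (SUP x\<in>Obj X. Hom Y y' (f x) * ?\<mu> x) \<rightarrow>\<^sub>q Hom Y y' z)"
      by (rule cocones_extended_weight[OF Y f' z, symmetric])
    finally show "Hom Y y z = (INF y'\<in>Obj Y.
        (\<lambda>y'\<in>Obj Y. SUP x\<in>Obj X. Hom Y y' (f x) * ?\<mu> x) y' \<rightarrow>\<^sub>q Hom Y y' z)"
      by simp
  qed
  with nerve_in_presheaves[OF Y f y]
  show "\<exists>\<mu>\<in>presheaves X. is_supremum Y (\<lambda>y'\<in>Obj Y. SUP x\<in>Obj X. Hom Y y' (f x) * \<mu> x) y"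
    by blast
qed

lemma tensor_Obj: "tensor_choice X star \<Longrightarrow> x \<in> Obj X \<Longrightarrow> star v x \<in> Obj X"
  by (simp add: tensor_choice_def is_tensor_def)

lemma Hom_tensor:
  "tensor_choice X star \<Longrightarrow> x \<in> Obj X \<Longrightarrow> y \<in> Obj X \<Longrightarrow>
    Hom X (star v x) y = v \<rightarrow>\<^sub>q Hom X x y"
  by (simp add: tensor_choice_def is_tensor_def)

text \<open>The unit of the adjunction between tensoring with \<open>x\<close> and homming out of
  \<open>x\<close>: it corresponds to the identity of \<open>star v x\<close>.\<close>

lemma tensor_unit:
  assumes X: "vcategory X" and t: "tensor_choice X star" and x: "x \<in> Obj X"
  shows "v \<le> Hom X x (star v x)"
proof -
  have "1 \<le> v \<rightarrow>\<^sub>q Hom X x (star v x)"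
    using Hom_refl[OF X tensor_Obj[OF t x]] Hom_tensor[OF t x tensor_Obj[OF t x]] by metis
  then show ?thesis
    by (simp flip: qimp_adjoint)
qed

lemma iota_in_vfun:
  assumes A: "vcategory A" and X: "vcategory X" and t: "tensor_choice X star"
    and a: "a \<in> Obj A" and x: "x \<in> Obj X"
  shows "iota A star (a, x) \<in> Obj (vfun (vop A) X)"
proof -
  have "Hom A c b \<le> Hom X (star (Hom A b a) x) (star (Hom A c a) x)"
    if b: "b \<in> Obj A" and c: "c \<in> Obj A" for b c
  proof -
    have "Hom A c b * Hom A b a \<le> Hom A c a"
      using A c b a by (rule Hom_comp)
    also have "\<dots> \<le> Hom X x (star (Hom A c a) x)"
      using X t x by (rule tensor_unit)
    finally show ?thesis
      by (simp add: qimp_adjoint Hom_tensor[OF t x tensor_Obj[OF t x]])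
  qed
  then show ?thesis
    by (simp add: Obj_vfun_iff vfunctor_def iota_def tensor_Obj[OF t x])
qed

text \<open>Mapping out of the tensor turns the hom into the meet of
  \<open>A(b, a) \<rightarrow> X(x, g b)\<close> over \<open>b\<close>, which the Yoneda lemma in \<open>A\<close> evaluates for
  the presheaf \<open>X(x, g -)\<close>.\<close>

lemma Hom_iota:
  assumes A: "vcategory A" and X: "vcategory X" and t: "tensor_choice X star"
    and a: "a \<in> Obj A" and x: "x \<in> Obj X" and g: "g \<in> Obj (vfun (vop A) X)"
  shows "Hom (vfun (vop A) X) (iota A star (a, x)) g = Hom X x (g a)"
proof -
  have g: "vfunctor (vop A) X g"
    using g by (simp add: Obj_vfun_iff)
  have gO: "g b \<in> Obj X" if "b \<in> Obj A" for b
    using vfunctor_Obj[OF g] that by simp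
  have act: "Hom A b a * Hom X x (g a) \<le> Hom X x (g b)" if b: "b \<in> Obj A" for b
  proof -
    have "Hom X x (g a) * Hom A b a \<le> Hom X x (g a) * Hom X (g a) (g b)"
      using vfunctor_Hom[OF g, of a b] a b by (intro mult_mono_quantale) simp
    also have "\<dots> \<le> Hom X x (g b)"
      using X x gO[OF a] gO[OF b] by (rule Hom_comp)
    finally show ?thesis
      by (simp add: mult.commute)
  qed
  have "Hom (vfun (vop A) X) (iota A star (a, x)) g
      = (INF b\<in>Obj A. Hom A b a \<rightarrow>\<^sub>q Hom X x (g b))"
    by (simp add: iota_def Hom_tensor[OF t x gO])
  also have "\<dots> = Hom X x (g a)"
    using A a act by (rule yoneda[where P = "\<lambda>b. Hom X x (g b)"])
  finally show ?thesis .
qed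

lemma iota_vbifunctor:
  assumes A: "vcategory A" and X: "vcategory X" and t: "tensor_choice X star"
  shows "vbifunctor A X (vfun (vop A) X) (iota A star)"
proof -
  have "Hom A a a' * Hom X x x' \<le> Hom (vfun (vop A) X) (iota A star (a, x)) (iota A star (a', x'))"
    if a: "a \<in> Obj A" and a': "a' \<in> Obj A" and x: "x \<in> Obj X" and x': "x' \<in> Obj X"
    for a a' x x'
  proof -
    have "Hom X x x' * Hom A a a' \<le> Hom X x x' * Hom X x' (star (Hom A a a') x')"
      using tensor_unit[OF X t x'] by (rule mult_mono_quantale)
    also have "\<dots> \<le> Hom X x (star (Hom A a a') x')"
      using X x x' tensor_Obj[OF t x'] by (rule Hom_comp)
    also have "\<dots> = Hom X x (iota A star (a', x') a)"
      using a by (simp add: iota_def)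
    also have "\<dots> = Hom (vfun (vop A) X) (iota A star (a, x)) (iota A star (a', x'))"
      using Hom_iota[OF A X t a x iota_in_vfun[OF A X t a' x']] by (rule sym)
    finally show ?thesis
      by (simp only: mult.commute)
  qed
  moreover have "iota A star \<in> Obj A \<times> Obj X \<rightarrow> Obj (vfun (vop A) X)"
    using iota_in_vfun[OF A X t] by auto
  ultimately show ?thesis
    unfolding vfunctor_def by (auto simp del: Hom_vfun)
qed

lemma iota_dense:
  assumes A: "vcategory A" and X: "vcategory X" and t: "tensor_choice X star"
  shows "vdense (A \<otimes>\<^sub>v X) (vfun (vop A) X) (iota A star)"
proof (rule dense_if_nerve_fully_faithful)
  let ?Y = "vfun (vop A) X"
  show "vcategory ?Y"
    using X by (rule vcategory_vfun)
  show "vfunctor (A \<otimes>\<^sub>v X) ?Y (iota A star)"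
    using A X t by (rule iota_vbifunctor)
  fix g h assume g: "g \<in> Obj ?Y" and h: "h \<in> Obj ?Y"
  have O: "g a \<in> Obj X" "h a \<in> Obj X" if "a \<in> Obj A" for a
    using g h that by (auto simp: Obj_vfun_iff dest: vfunctor_Obj)
  have "Hom ?Y g h = (INF a\<in>Obj A. INF x\<in>Obj X. Hom X x (g a) \<rightarrow>\<^sub>q Hom X x (h a))"
    by (simp add: yoneda_Hom[OF X] O)
  also have "\<dots> = (INF a\<in>Obj A. INF x\<in>Obj X.
      Hom ?Y (iota A star (a, x)) g \<rightarrow>\<^sub>q Hom ?Y (iota A star (a, x)) h)"
    by (simp add: Hom_iota[OF A X t] g h del: Hom_vfun)
  also have "\<dots> = (INF p\<in>Obj (A \<otimes>\<^sub>v X).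
      Hom ?Y (iota A star p) g \<rightarrow>\<^sub>q Hom ?Y (iota A star p) h)"
    by (rule order.antisym)
      (auto intro!: INF_greatest intro: INF_lower INF_lower2 simp del: Hom_vfun)
  finally show "Hom ?Y g h = (INF p\<in>Obj (A \<otimes>\<^sub>v X).
      Hom ?Y (iota A star p) g \<rightarrow>\<^sub>q Hom ?Y (iota A star p) h)" .
qed

lemma vop_vop [simp]: "vop (vop X) = X"
  by (simp add: vop_def)

lemma vop_vtimes: "vop (X \<otimes>\<^sub>v Y) = vop X \<otimes>\<^sub>v vop Y"
  by (simp add: vop_def vtimes_def fun_eq_iff split: prod.splits)

lemma vfunctor_vop: "vfunctor (vop X) (vop Y) f \<longleftrightarrow> vfunctor X Y f"
  by (auto simp: vfunctor_def)

lemma is_infimum_vop: "is_infimum (vop Y) \<phi> y \<longleftrightarrow> is_supremum Y \<phi> y"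
  by (simp add: is_infimum_def is_supremum_def)

lemma vcodense_vop: "vcodense (vop X) (vop Y) f \<longleftrightarrow> vdense X Y f"
  by (simp add: vcodense_def vdense_def is_infimum_vop)

lemma iota_vop: "iota (vop A) star = iota_dagger A star"
  by (simp add: iota_def iota_dagger_def)

theorem proposition4p7:
  fixes A :: "('a, 'v::comm_quantale) vcat"
    and X :: "('x, 'v) vcat"
    and star :: "'v \<Rightarrow> 'x \<Rightarrow> 'x"
  assumes "vcategory A"
    and "vcategory X"
    and "vcomplete X"
    and "tensor_choice X star"
  shows "(vbifunctor A X (vfun (vop A) X) (iota A star) \<and>
          vdense (A \<otimes>\<^sub>v X) (vfun (vop A) X) (iota A star)) \<and>
         (vbifunctor A (vop X) (vop (vfun A X)) (iota_dagger A star) \<and>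
          vcodense (A \<otimes>\<^sub>v vop X) (vop (vfun A X)) (iota_dagger A star))"
proof -
  have op: "A \<otimes>\<^sub>v vop X = vop (vop A \<otimes>\<^sub>v X)"
    by (simp add: vop_vtimes)
  have A': "vcategory (vop A)"
    using assms(1) by (rule vcategory_vop)
  have "vbifunctor A (vop X) (vop (vfun A X)) (iota_dagger A star)"
    using iota_vbifunctor[OF A' assms(2,4)] by (simp add: op vfunctor_vop iota_vop)
  moreover have "vcodense (A \<otimes>\<^sub>v vop X) (vop (vfun A X)) (iota_dagger A star)"
    using iota_dense[OF A' assms(2,4)] by (simp add: op vcodense_vop iota_vop)
  ultimately show ?thesis
    using iota_vbifunctor[OF assms(1,2,4)] iota_dense[OF assms(1,2,4)] by blast
qed

end
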